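(* In the setting of the adaptive implicit-explicit iteration described in the context, let $a>0$ and $\eta_{\min}>0$, and suppose the step size satisfies $0<\eta_{\min}\le\eta\le\frac1{\|\bm T\|+2a}$. Then there exists $b>0$ such that for every $k\ge0$, $\left\|\begin{pmatrix}\nabla_{\bm d}L(\bm d_{k+1},\beta_{k+1})\\ \nabla_\beta L(\bm d_{k+1},\beta_{k+1})\end{pmatrix}\right\|_2\le b\,\|\bm d_{k+1}-\bm d_k\|_2.$
   Context: Let $n\ge1$, $r>0$, $\bm g\in\mathbb R^n$ with $\bm g\neq0$, and $\bm H=\bm D+\bm T\in\mathbb R^{n\times n}$, where $\bm D$ is diagonal with nonnegative diagonal entries $D_{i,i}$ and $\bm T$ is symmetric; $\|\bm T\|$ is the spectral norm. Let $f(\bm d)=\bm g^\top\bm d+\frac12\bm d^\top\bm H\bm d$ and $L(\bm d,\beta)=f(\bm d)+\frac{\beta^2}{2}(\|\bm d\|_2^2-r^2)$ for $\bm d\in\mathbb R^n$, $\beta\in\mathbb R$. Adaptive implicit-explicit iteration with step size $\eta>0$: set $\bm d_0=-r\bm g/\|\bm g\|_2$. For $k=0,1,2,\dots$: let $\bm b_k=\bm d_k-\eta(\bm g+\bm T\bm d_k)$ and $\phi_k(\lambda)=\sum_{i=1}^n\big([\bm b_k]_i/(1+\eta(D_{i,i}+\lambda))\big)^2$; set $\lambda_{k+1}=0$ if $\phi_k(0)\le r^2$, and otherwise let $\lambda_{k+1}>0$ be the solution of $\phi_k(\lambda)=r^2$; then $\bm d_{k+1}=(\bm I+\eta(\bm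 D+\lambda_{k+1}\bm I))^{-1}\bm b_k$. Finally $\beta_k=\sqrt{\lambda_k}$. *)

theory Defs
  imports "HOL-Analysis.Analysis"
begin

text \<open>Objective f(d) = g.d + 1/2 d.(H d) and Lagrangian
  L(d,beta) = f(d) + beta^2/2 (norm d ^2 - r^2).\<close>

definition fobj :: "real^'n \<Rightarrow> real^'n^'n \<Rightarrow> real^'n \<Rightarrow> real" where
  "fobj g H d = g \<bullet> d + (1/2) * (d \<bullet> (H *v d))"

definition Lag :: "real^'n \<Rightarrow> real^'n^'n \<Rightarrow> real \<Rightarrow> real^'n \<Rightarrow> real \<Rightarrow> real" where
  "Lag g H r d \<beta> = fobj g H d + (\<beta>^2 / 2) * ((norm d)^2 - r^2)"

text \<open>Gradient of L with respect to d (for symmetric H) and with respect to beta.\<close>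

definition gradL_d :: "real^'n \<Rightarrow> real^'n^'n \<Rightarrow> real \<Rightarrow> real^'n \<Rightarrow> real \<Rightarrow> real^'n" where
  "gradL_d g H r d \<beta> = g + H *v d + (\<beta>^2) *\<^sub>R d"

definition gradL_beta :: "real^'n \<Rightarrow> real^'n^'n \<Rightarrow> real \<Rightarrow> real^'n \<Rightarrow> real \<Rightarrow> real" where
  "gradL_beta g H r d \<beta> = \<beta> * ((norm d)^2 - r^2)"

lemma symdot: fixes H :: "real^'n^'n" assumes "transpose H = H"
  shows "d \<bullet> (H *v h) = (H *v d) \<bullet> h"
  by (metis assms dot_lmul_matrix inner_commute transpose_transpose vector_transpose_matrix)
lemma Lag_derivative_aux:
  fixes H :: "real^'n^'n" and g :: "real^'n"
  assumes "transpose H = H"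
  shows "((\<lambda>(d, \<beta>). g \<bullet> d + (1/2) * (d \<bullet> (H *v d)) + (\<beta>^2 / 2) * ((norm d)^2 - r^2)) has_derivative
     (\<lambda>(h, t). (g + H *v d + (\<beta>^2) *\<^sub>R d) \<bullet> h + (\<beta> * ((norm d)^2 - r^2)) * t)) (at (d, \<beta>))"
proof -
  have bl: "bounded_linear (\<lambda>p::(real^'n)\<times>real. H *v fst p)"
    using bounded_linear_compose[OF matrix_vector_mul_bounded_linear[of H] bounded_linear_fst] by (simp add: o_def)
  have hm[derivative_intros]: "((\<lambda>p. H *v fst p) has_derivative (\<lambda>p. H *v fst p)) F" for F :: "((real^'n)\<times>real) filter"
    by (rule bounded_linear_imp_has_derivative[OF bl])
  have e: "((\<lambda>p. g \<bullet> fst p + (1/2) * (fst p \<bullet> (H *v fst p)) + ((snd p)^2 / 2) * (fst p \<bullet> fst p - r^2)) has_derivative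
     (\<lambda>p'. g \<bullet> fst p' + (1/2) * (fst p' \<bullet> (H *v d) + d \<bullet> (H *v fst p')) + ((2 * \<beta> * snd p') / 2) * (d \<bullet> d - r^2)
        + (\<beta>^2/2) * (fst p' \<bullet> d + d \<bullet> fst p'))) (at (d,\<beta>))"
    apply (rule has_derivative_eq_rhs)
     apply (auto intro!: derivative_eq_intros)[1]
    apply (simp add: fun_eq_iff add_divide_distrib)
    done
  have f1: "(\<lambda>(d, \<beta>). g \<bullet> d + (1/2) * (d \<bullet> (H *v d)) + (\<beta>^2 / 2) * ((norm d)^2 - r^2))
     = (\<lambda>p. g \<bullet> fst p + (1/2) * (fst p \<bullet> (H *v fst p)) + ((snd p)^2 / 2) * (fst p \<bullet> fst p - r^2))"
    by (simp add: fun_eq_iff power2_norm_eq_inner)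
  have f2: "(\<lambda>(h, t). (g + H *v d + (\<beta>^2) *\<^sub>R d) \<bullet> h + (\<beta> * ((norm d)^2 - r^2)) * t)
     = (\<lambda>p'. g \<bullet> fst p' + (1/2) * (fst p' \<bullet> (H *v d) + d \<bullet> (H *v fst p')) + ((2 * \<beta> * snd p') / 2) * (d \<bullet> d - r^2)
        + (\<beta>^2/2) * (fst p' \<bullet> d + d \<bullet> fst p'))"
  proof (rule ext, clarify)
    fix h t
    have a: "d \<bullet> (H *v h) = (H *v d) \<bullet> h" by (rule symdot[OF assms])
    have b: "h \<bullet> (H *v d) = (H *v d) \<bullet> h" by (rule inner_commute)
    have c: "d \<bullet> h = h \<bullet> d" by (rule inner_commute)
    show "(g + H *v d + (\<beta>^2) *\<^sub>R d) \<bullet> h + (\<beta> * ((norm d)^2 - r^2)) * t =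
      g \<bullet> fst (h,t) + (1/2) * (fst (h,t) \<bullet> (H *v d) + d \<bullet> (H *v fst (h,t))) + ((2 * \<beta> * snd (h,t)) / 2) * (d \<bullet> d - r^2)
        + (\<beta>^2/2) * (fst (h,t) \<bullet> d + d \<bullet> fst (h,t))"
      unfolding fst_conv snd_conv a b c inner_add_left inner_scaleR_left power2_norm_eq_inner
      by (simp add: algebra_simps)
  qed
  show ?thesis unfolding f1 f2 by (rule e)
qed

lemma Lag_has_derivative:
  assumes "transpose H = H"
  shows "((\<lambda>(d, \<beta>). Lag g H r d \<beta>) has_derivative
     (\<lambda>(h, t). gradL_d g H r d \<beta> \<bullet> h + gradL_beta g H r d \<beta> * t)) (at (d, \<beta>))"
  unfolding Lag_def fobj_def gradL_d_def gradL_beta_def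
  by (rule Lag_derivative_aux[OF assms])

text \<open>phi_k(lambda) = sum_i (b_i / (1 + eta (D_ii + lambda)))^2\<close>

definition phi :: "real^'n^'n \<Rightarrow> real \<Rightarrow> real^'n \<Rightarrow> real \<Rightarrow> real" where
  "phi D \<eta> b lam = (\<Sum>i\<in>UNIV. (b $ i / (1 + \<eta> * (D $ i $ i + lam)))^2)"

definition lam_next :: "real^'n^'n \<Rightarrow> real \<Rightarrow> real \<Rightarrow> real^'n \<Rightarrow> real" where
  "lam_next D \<eta> r b =
     (if phi D \<eta> b 0 \<le> r^2 then 0 else (THE lam. lam > 0 \<and> phi D \<eta> b lam = r^2))"

text \<open>One step: given d_k, return (d_{k+1}, lambda_{k+1}).\<close>

definition aie_step :: "real^'n \<Rightarrow> real^'n^'n \<Rightarrow> real^'n^'n \<Rightarrow> real \<Rightarrow> real \<Rightarrow> real^'n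
    \<Rightarrow> (real^'n) \<times> real" where
  "aie_step g D T r \<eta> d =
     (let b = d - \<eta> *\<^sub>R (g + T *v d);
          l = lam_next D \<eta> r b
      in (matrix_inv (mat 1 + \<eta> *\<^sub>R (D + l *\<^sub>R mat 1)) *v b, l))"

text \<open>aie_iter k = (d_k, lambda_k); lambda_0 is not used by the method and set to 0.\<close>

fun aie_iter :: "real^'n \<Rightarrow> real^'n^'n \<Rightarrow> real^'n^'n \<Rightarrow> real \<Rightarrow> real \<Rightarrow> nat
    \<Rightarrow> (real^'n) \<times> real" where
  "aie_iter g D T r \<eta> 0 = (- (r / norm g) *\<^sub>R g, 0)"
| "aie_iter g D T r \<eta> (Suc k) = aie_step g D T r \<eta> (fst (aie_iter g D T r \<eta> k))"

definition dk :: "real^'n \<Rightarrow> real^'n^'n \<Rightarrow> real^'n^'n \<Rightarrow> real \<Rightarrow> real \<Rightarrow> nat \<Rightarrow> real^'n" where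
  "dk g D T r \<eta> k = fst (aie_iter g D T r \<eta> k)"

definition lamk :: "real^'n \<Rightarrow> real^'n^'n \<Rightarrow> real^'n^'n \<Rightarrow> real \<Rightarrow> real \<Rightarrow> nat \<Rightarrow> real" where
  "lamk g D T r \<eta> k = snd (aie_iter g D T r \<eta> k)"

definition betak :: "real^'n \<Rightarrow> real^'n^'n \<Rightarrow> real^'n^'n \<Rightarrow> real \<Rightarrow> real \<Rightarrow> nat \<Rightarrow> real" where
  "betak g D T r \<eta> k = sqrt (lamk g D T r \<eta> k)"

end

theory Submission
  imports Defs
begin

text \<open>Componentwise, the update d_{k+1} = (I + eta (D + lam_{k+1} I))^{-1} b_k says exactly
  g + H d_{k+1} + lam_{k+1} d_{k+1} = T (d_{k+1} - d_k) - (d_{k+1} - d_k) / eta, i.e. the d-gradient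
  of L at (d_{k+1}, beta_{k+1}) is a bounded linear image of the step d_{k+1} - d_k.
  The multiplier is complementary to the constraint: either lam_{k+1} = 0, or it is the root of the
  secular equation phi_k(lam) = r^2, which is unique because phi_k is continuous and strictly
  decreasing on [0, \<infinity>) with limit 0; since phi_k(lam_{k+1}) = norm d_{k+1}^2, the beta-gradient
  vanishes. Hence the gradient norm is at most (norm T + 1/eta_min) norm (d_{k+1} - d_k).\<close>

lemma diagonal_matrix_vector_mult:
  fixes A :: "'a::semiring_1^'n^'n"
  assumes "\<And>i j. i \<noteq> j \<Longrightarrow> A $ i $ j = 0"
  shows "(A *v x) $ i = A $ i $ i * x $ i"
proof -
  have "(A *v x) $ i = (\<Sum>j\<in>UNIV. if j = i then A $ i $ i * x $ j else 0)"
    unfolding matrix_vector_mult_def vec_lambda_beta by (rule sum.cong) (auto simp: assms)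
  then show ?thesis by simp
qed

lemma matrix_inv_mult_cancel:
  fixes A :: "'a::comm_semiring_1^'n^'n"
  assumes "invertible A"
  shows "matrix_inv A *v (A *v x) = x"
proof -
  have "matrix_inv A ** A = mat 1"
    using assms unfolding invertible_def matrix_inv_def by (rule someI2_ex) auto
  then show ?thesis by (simp add: matrix_vector_mul_assoc)
qed

lemma matrix_inv_diagonal_mult:
  fixes A :: "'a::field^'n^'n"
  assumes diag: "\<And>i j. i \<noteq> j \<Longrightarrow> A $ i $ j = 0" and nz: "\<And>i. A $ i $ i \<noteq> 0"
  shows "matrix_inv A *v b = (\<chi> i. b $ i / A $ i $ i)"
proof -
  have mult: "(A *v x) $ i = A $ i $ i * x $ i" for x i
    by (rule diagonal_matrix_vector_mult[OF diag])
  have "inj ((*v) A)"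
    by (rule injI) (metis mult nz mult_left_cancel vec_eq_iff)
  then have "invertible A"
    using invertible_left_inverse matrix_left_invertible_injective by blast
  moreover have "A *v (\<chi> i. b $ i / A $ i $ i) = b"
    using nz by (simp add: vec_eq_iff mult)
  ultimately show ?thesis
    by (metis matrix_inv_mult_cancel)
qed

lemma power2_divide_antimono:
  fixes c u w :: real
  assumes "0 < u" "u \<le> w"
  shows "(c / w)^2 \<le> (c / u)^2"
  using assms by (simp add: power_divide divide_left_mono mult_pos_pos power_mono)

lemma power2_divide_strict_antimono:
  fixes c u w :: real
  assumes "0 < u" "u < w" "c \<noteq> 0"
  shows "(c / w)^2 < (c / u)^2"
  using assms by (simp add: power_divide divide_strict_left_mono mult_pos_pos power_strict_mono)

lemma phi_strict_antimono:
  fixes D :: "real^'n^'n"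
  assumes eta: "\<eta> > 0" and D_nonneg: "\<And>i. D $ i $ i \<ge> 0" and b: "b \<noteq> 0"
    and "0 \<le> x" "x < y"
  shows "phi D \<eta> b y < phi D \<eta> b x"
proof -
  obtain i0 where i0: "b $ i0 \<noteq> 0"
    using b by (auto simp: vec_eq_iff)
  have pos: "0 < 1 + \<eta> * (D $ i $ i + x)" for i
    using eta D_nonneg[of i] \<open>0 \<le> x\<close> by (simp add: add_pos_nonneg)
  have less: "1 + \<eta> * (D $ i $ i + x) < 1 + \<eta> * (D $ i $ i + y)" for i
    using eta \<open>x < y\<close> by simp
  show ?thesis
    unfolding phi_def
  proof (rule sum_strict_mono_ex1)
    show "\<forall>i\<in>UNIV. (b $ i / (1 + \<eta> * (D $ i $ i + y)))^2 \<le> (b $ i / (1 + \<eta> * (D $ i $ i + x)))^2"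
      using pos less by (simp add: power2_divide_antimono less_imp_le)
    show "\<exists>i\<in>UNIV. (b $ i / (1 + \<eta> * (D $ i $ i + y)))^2 < (b $ i / (1 + \<eta> * (D $ i $ i + x)))^2"
      using pos less i0 by (blast intro: power2_divide_strict_antimono)
  qed simp
qed

lemma phi_continuous_on:
  fixes D :: "real^'n^'n"
  assumes eta: "\<eta> > 0" and D_nonneg: "\<And>i. D $ i $ i \<ge> 0"
  shows "continuous_on {0..} (phi D \<eta> b)"
  unfolding phi_def[abs_def]
proof (intro continuous_intros ballI)
  fix i and x :: real
  assume "x \<in> {0..}"
  then show "1 + \<eta> * (D $ i $ i + x) \<noteq> 0"
    using eta D_nonneg[of i] by (simp add: add_pos_nonneg less_imp_neq[symmetric])
qed

lemma phi_le:
  fixes D :: "real^'n^'n"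
  assumes eta: "\<eta> > 0" and D_nonneg: "\<And>i. D $ i $ i \<ge> 0" and "0 \<le> l"
  shows "phi D \<eta> b l \<le> (norm b)^2 / (1 + \<eta> * l)^2"
proof -
  have "phi D \<eta> b l \<le> (\<Sum>i\<in>UNIV. (b $ i / (1 + \<eta> * l))^2)"
    unfolding phi_def
  proof (rule sum_mono, rule power2_divide_antimono)
    fix i
    show "0 < 1 + \<eta> * l" using eta \<open>0 \<le> l\<close> by (simp add: add_pos_nonneg)
    show "1 + \<eta> * l \<le> 1 + \<eta> * (D $ i $ i + l)" using eta D_nonneg[of i] by simp
  qed
  also have "\<dots> = (norm b)^2 / (1 + \<eta> * l)^2"
    by (simp add: power_divide sum_divide_distrib norm_vec_def L2_set_def sum_nonneg)
  finally show ?thesis .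
qed

lemma phi_eventually_less:
  fixes D :: "real^'n^'n"
  assumes eta: "\<eta> > 0" and D_nonneg: "\<And>i. D $ i $ i \<ge> 0" and r: "r > 0"
  obtains l where "0 \<le> l" "phi D \<eta> b l < r^2"
proof
  define t where "t = (norm b)^2 / r^2"
  have t: "0 \<le> t" "(norm b)^2 = r^2 * t"
    using r by (simp_all add: t_def)
  show "0 \<le> t / \<eta>" using t eta by simp
  have "phi D \<eta> b (t / \<eta>) \<le> r^2 * t / (1 + t)^2"
    using phi_le[OF eta D_nonneg, of "t / \<eta>" b] t eta by simp
  also have "\<dots> < r^2"
    using t r by (simp add: divide_less_eq power2_eq_square algebra_simps add_pos_nonneg)
  finally show "phi D \<eta> b (t / \<eta>) < r^2" .
qed

lemma secular_equation_unique_solution: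
  fixes D :: "real^'n^'n"
  assumes eta: "\<eta> > 0" and D_nonneg: "\<And>i. D $ i $ i \<ge> 0" and r: "r > 0"
    and above: "phi D \<eta> b 0 > r^2"
  shows "\<exists>!l. l > 0 \<and> phi D \<eta> b l = r^2"
proof -
  have "b \<noteq> 0"
    using above by (auto simp: phi_def)
  note strict = phi_strict_antimono[OF eta D_nonneg this]
  obtain M where M: "0 \<le> M" "phi D \<eta> b M < r^2"
    using phi_eventually_less[OF eta D_nonneg r] .
  have "continuous_on {0..M} (phi D \<eta> b)"
    using phi_continuous_on[OF eta D_nonneg] by (rule continuous_on_subset) auto
  then obtain l where l: "0 \<le> l" "phi D \<eta> b l = r^2"
    using IVT2'[of "phi D \<eta> b" M "r^2" 0] M above by auto
  with above have "l > 0"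
    by (cases "l = 0") auto
  moreover have "l' = l" if "l' > 0" "phi D \<eta> b l' = r^2" for l'
  proof (rule ccontr)
    assume "l' \<noteq> l"
    then consider "l' < l" | "l < l'" by linarith
    then show False
      using strict[of l' l] strict[of l l'] that l by cases auto
  qed
  ultimately show ?thesis
    using l by blast
qed

lemma lam_next_secular:
  fixes D :: "real^'n^'n"
  assumes "\<eta> > 0" "\<And>i. D $ i $ i \<ge> 0" "r > 0"
  shows "lam_next D \<eta> r b \<ge> 0" and "lam_next D \<eta> r b = 0 \<or> phi D \<eta> b (lam_next D \<eta> r b) = r^2"
proof -
  have "lam_next D \<eta> r b > 0 \<and> phi D \<eta> b (lam_next D \<eta> r b) = r^2" if "\<not> phi D \<eta> b 0 \<le> r^2"
    using theI'[OF secular_equation_unique_solution[OF assms]] that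
    by (simp add: lam_next_def)
  then show "lam_next D \<eta> r b \<ge> 0" and "lam_next D \<eta> r b = 0 \<or> phi D \<eta> b (lam_next D \<eta> r b) = r^2"
    by (auto simp: lam_next_def)
qed

lemma aie_step_eq:
  fixes D :: "real^'n^'n"
  assumes D_diag: "\<And>i j. i \<noteq> j \<Longrightarrow> D $ i $ j = 0" and D_nonneg: "\<And>i. D $ i $ i \<ge> 0"
    and eta: "\<eta> > 0" and r: "r > 0"
    and b: "b = d - \<eta> *\<^sub>R (g + T *v d)" and l: "l = lam_next D \<eta> r b"
  shows "aie_step g D T r \<eta> d = ((\<chi> i. b $ i / (1 + \<eta> * (D $ i $ i + l))), l)"
proof -
  have "l \<ge> 0"
    unfolding l by (rule lam_next_secular(1)[OF eta D_nonneg r])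
  then have "1 + \<eta> * (D $ i $ i + l) \<noteq> 0" for i
    using eta D_nonneg[of i] by (simp add: add_pos_nonneg less_imp_neq[symmetric])
  then have "matrix_inv (mat 1 + \<eta> *\<^sub>R (D + l *\<^sub>R mat 1)) *v b
      = (\<chi> i. b $ i / (1 + \<eta> * (D $ i $ i + l)))"
    using D_diag by (subst matrix_inv_diagonal_mult) (auto simp: mat_def)
  then show ?thesis
    unfolding aie_step_def Let_def b[symmetric] l[symmetric] by simp
qed

lemma aie_step_stationary:
  fixes D T :: "real^'n^'n"
  assumes D_diag: "\<And>i j. i \<noteq> j \<Longrightarrow> D $ i $ j = 0" and D_nonneg: "\<And>i. D $ i $ i \<ge> 0"
    and eta: "\<eta> > 0" and r: "r > 0"
    and step: "aie_step g D T r \<eta> d = (v, l)"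
  shows "gradL_beta g (D + T) r v (sqrt l) = 0"
    and "gradL_d g (D + T) r v (sqrt l) = T *v (v - d) - (1 / \<eta>) *\<^sub>R (v - d)"
proof -
  define b where "b = d - \<eta> *\<^sub>R (g + T *v d)"
  have l: "l = lam_next D \<eta> r b" and v: "v = (\<chi> i. b $ i / (1 + \<eta> * (D $ i $ i + l)))"
    using aie_step_eq[OF D_diag D_nonneg eta r b_def refl] step by simp_all
  have "l \<ge> 0"
    unfolding l by (rule lam_next_secular(1)[OF eta D_nonneg r])
  then have sqrt_l: "sqrt l ^ 2 = l"
    by simp
  have "(norm v)^2 = phi D \<eta> b l"
    unfolding v phi_def power2_norm_eq_inner inner_vec_def by (simp add: power2_eq_square)
  then show "gradL_beta g (D + T) r v (sqrt l) = 0"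
    using lam_next_secular(2)[OF eta D_nonneg r, of b] unfolding gradL_beta_def l[symmetric] by auto
  have "g $ i + (T *v d) $ i + (D $ i $ i + l) * v $ i = (d $ i - v $ i) / \<eta>" for i
    using \<open>l \<ge> 0\<close> eta D_nonneg[of i]
    by (simp add: v b_def add_pos_nonneg less_imp_neq[symmetric] field_simps)
  then show "gradL_d g (D + T) r v (sqrt l) = T *v (v - d) - (1 / \<eta>) *\<^sub>R (v - d)"
    by (simp add: vec_eq_iff gradL_d_def sqrt_l matrix_vector_mult_add_rdistrib
        matrix_vector_mult_diff_distrib diagonal_matrix_vector_mult[OF D_diag]
        algebra_simps diff_divide_distrib)
qed

lemma norm_matrix_vector_mult_diff_scaleR_le:
  fixes A :: "real^'n^'n"
  shows "norm (A *v x - c *\<^sub>R x) \<le> (onorm ((*v) A) + \<bar>c\<bar>) * norm x"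
proof -
  have "norm (A *v x - c *\<^sub>R x) \<le> norm (A *v x) + norm (c *\<^sub>R x)"
    by (rule norm_triangle_ineq4)
  also have "\<dots> \<le> onorm ((*v) A) * norm x + \<bar>c\<bar> * norm x"
    using onorm[OF matrix_vector_mul_bounded_linear[of A], of x] by simp
  finally show ?thesis
    by (simp add: distrib_right)
qed

lemma aie_iter_gradL_le:
  fixes D T :: "real^'n^'n"
  assumes D_diag: "\<And>i j. i \<noteq> j \<Longrightarrow> D $ i $ j = 0" and D_nonneg: "\<And>i. D $ i $ i \<ge> 0"
    and eta: "\<eta> > 0" and r: "r > 0"
  shows "norm (gradL_d g (D + T) r (dk g D T r \<eta> (Suc k)) (betak g D T r \<eta> (Suc k)),
           gradL_beta g (D + T) r (dk g D T r \<eta> (Suc k)) (betak g D T r \<eta> (Suc k)))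
       \<le> (onorm ((*v) T) + 1 / \<eta>) * norm (dk g D T r \<eta> (Suc k) - dk g D T r \<eta> k)"
proof -
  define d where "d = dk g D T r \<eta> k"
  obtain v l where step: "aie_step g D T r \<eta> d = (v, l)"
    by fastforce
  then have v: "dk g D T r \<eta> (Suc k) = v" and "betak g D T r \<eta> (Suc k) = sqrt l"
    by (simp_all add: d_def dk_def betak_def lamk_def)
  then have "norm (gradL_d g (D + T) r (dk g D T r \<eta> (Suc k)) (betak g D T r \<eta> (Suc k)),
           gradL_beta g (D + T) r (dk g D T r \<eta> (Suc k)) (betak g D T r \<eta> (Suc k)))
        = norm (T *v (v - d) - (1 / \<eta>) *\<^sub>R (v - d))"
    using aie_step_stationary[OF D_diag D_nonneg eta r step] by simp
  also have "\<dots> \<le> (onorm ((*v) T) + 1 / \<eta>) * norm (v - d)"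
    using norm_matrix_vector_mult_diff_scaleR_le[of T "v - d" "1 / \<eta>"] eta by simp
  finally show ?thesis
    by (simp add: v d_def)
qed

theorem mainTheorem5:
  fixes g :: "real^'n" and D T :: "real^'n^'n" and r a \<eta>min \<eta> :: real
  assumes r_pos: "r > 0"
    and g_nz: "g \<noteq> 0"
    and D_diag: "\<And>i j. i \<noteq> j \<Longrightarrow> D $ i $ j = 0"
    and D_nonneg: "\<And>i. D $ i $ i \<ge> 0"
    and T_sym: "transpose T = T"
    and a_pos: "a > 0"
    and etamin_pos: "\<eta>min > 0"
    and eta_lb: "\<eta>min \<le> \<eta>"
    and eta_ub: "\<eta> \<le> 1 / (onorm (\<lambda>x. T *v x) + 2 * a)"
  shows "\<exists>b > 0. \<forall>k::nat.
     norm (gradL_d g (D + T) r (dk g D T r \<eta> (Suc k)) (betak g D T r \<eta> (Suc k)),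
           gradL_beta g (D + T) r (dk g D T r \<eta> (Suc k)) (betak g D T r \<eta> (Suc k)))
       \<le> b * norm (dk g D T r \<eta> (Suc k) - dk g D T r \<eta> k)"
proof -
  have eta: "\<eta> > 0"
    using etamin_pos eta_lb by linarith
  define B where "B = onorm ((*v) T) + 1 / \<eta>min"
  have "B > 0"
    unfolding B_def using onorm_pos_le[OF matrix_vector_mul_bounded_linear[of T]] etamin_pos
    by (simp add: add_nonneg_pos)
  moreover have "onorm ((*v) T) + 1 / \<eta> \<le> B"
    unfolding B_def using etamin_pos eta_lb by (simp add: frac_le)
  ultimately show ?thesis
    by (blast intro: order_trans[OF aie_iter_gradL_le[OF D_diag D_nonneg eta r_pos]]
        mult_right_mono norm_ge_zero)
qed

end
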